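(* There exist an assignment $P$ from rewriting models to cartesian dynamical systems (with initial state) and an assignment $S$ from cartesian dynamical systems (with initial state) to rewriting models, such that: (1) for every rewriting model $M$ with output set $X$, the system $P(M)$ has output set $X$ and generates the same sequence $\mathbb{N}\to X$ as $M$; (2) for every cartesian dynamical system $D$ with output set $X$, the rewriting model $S(D)$ has output set $X$ and generates the same sequence $\mathbb{N}\to X$ as $D$; (3) $P(S(D)) = D$ for every cartesian dynamical system $D$. That is, the class of cartesian dynamical systems embeds (via $S$) in the class of rewriting models, and the rewriting models project (via $P$) onto the cartesian dynamical systems, this projection admitting the section $S$.
   Context: Cartesian dynamical systems. A dynamical system is a pair of sets $(X,Y)$ (output set $X$, latent set $Y$) with maps $G:Y\to Y$ and $f:Y\to X$. It is cartesian if $Y=X^d$ for some $d\in\mathbb{N}$. Here it is taken together with an initial state $y_0\in Y$, so a cartesian dynamical system is a tuple $(X,d,G,f,y_0)$ with $G:X^d\to X^d$, $f:X^d\to X$, $y_0\in X^d$; the sequence it generates is $n\mapsto f(G^n(y_0))$. Terms. A signature $\Sigma$ assigns to each $n\in\mathbb{N}$ a set $\Sigma_n$ of $n$-ary operators. For a set $V$ of variables disjoint from $\Sigma$, $T(V)=T(\Sigma,V)$ is the set of $\Sigma$-terms over $V$: the smallest set containing $V$ and containing $f(t_1,\dots,t_n)$ for all $f\in\Sigma_n$ and $t_i\in T(V)$. Ground terms are the elements of $T=T(\Sigma,\varnothing)$. The set $Pos(s)$ of positions of a term $s$ is a set of finite strings of positive integers: $Pos(v)=\{\epsilon\}$ (the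 empty string) for $v\in V$, and $Pos(f(s_1,\dots,s_n))=\{\epsilon\}\cup\bigcup_i\{ip: p\in Pos(s_i)\}$. The subterm $s|_p$ at $p\in Pos(s)$ is given by $s|_\epsilon=s$, $f(s_1,\dots,s_n)|_{iq}=s_i|_q$. The term $s[t]_p$ obtained by replacing the subterm at $p$ by $t$ is given by $s[t]_\epsilon=t$, $f(s_1,\dots,s_n)[t]_{iq}=f(s_1,\dots,s_i[t]_q,\dots,s_n)$. $Var(s)$ is the set of variables occurring in $s$. A substitution is a map $\sigma:V\to T(V)$, extended to $T(V)\to T(V)$ by $\sigma(f(s_1,\dots,s_n))=f(\sigma(s_1),\dots,\sigma(s_n))$. Rewriting functions. For a term $s$ and position $p$, $T_p^s=\{t\in T(V): p\in Pos(t),\ t|_p=\sigma(s)\text{ for some substitution }\sigma\}$. For terms $l,r\in T(V)$ with $Var(r)\subseteq Var(l)$ the rewriting function $R_p:T_p^l\to T_p^r$ sends $t$ with $t|_p=\sigma(l)$ to $t[\sigma(r)]_p$ (independent of the choice of $\sigma$). If $r=\tau(l)$ for a substitution $\tau$, then $T_p^r\subseteq T_p^l$, so $R_p$ can be iterated. Ground terms are preserved by $R_p$. Algebras. A $\Sigma$-algebra $(X,c)$ is a set $X$ with a function $c_\sigma:X^n\to X$ for each $\sigma\in\Sigma_n$ and each $n$. The catamorphism $\mathrm{cata}(c):T\to X$ is the unique $\Sigma$-algebra homomorphism from the ground terms, i.e. $\mathrm{cata}(c)(\sigma(t_1,\dots,t_n))=c_\sigma(\mathrm{cata}(c)(t_1),\dots,\mathrm{cata}(c)(t_n))$.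 Rewriting models. A rewriting model with output set $X$ consists of a signature $\Sigma$, a variable set $V$, a pair of terms $(l,r)$ in $T(V)$ with $Var(r)\subseteq Var(l)$ and $r=\tau(l)$ for some substitution $\tau$, a position $p$, a $\Sigma$-algebra $(X,c)$, and a ground initial term $t_0\in T_p^l$. The sequence it generates is the map $\mathbb{N}\to X$, $n\mapsto \mathrm{cata}(c)(R_p^n(t_0))$. *)

theory Defs
  imports Main "HOL-Library.FuncSet" "HOL-Library.NList"
begin

section \<open>Terms\<close>

text \<open>
  A signature is a map \<open>\<Sigma> :: nat \<Rightarrow> 'f set\<close>. The sets \<open>\<Sigma> n\<close> need not be disjoint; in an
  application \<open>Fun f ts\<close> the arity of \<open>f\<close> is the length of \<open>ts\<close>.
\<close>

datatype (funs: 'f, vars: 'v) trm = Var 'v | Fun 'f "('f, 'v) trm list"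

inductive_set terms :: "(nat \<Rightarrow> 'f set) \<Rightarrow> 'v set \<Rightarrow> ('f, 'v) trm set"
  for \<Sigma> :: "nat \<Rightarrow> 'f set" and V :: "'v set" where
  Var: "v \<in> V \<Longrightarrow> Var v \<in> terms \<Sigma> V"
| Fun: "f \<in> \<Sigma> (length ts) \<Longrightarrow> (\<And>t. t \<in> set ts \<Longrightarrow> t \<in> terms \<Sigma> V) \<Longrightarrow> Fun f ts \<in> terms \<Sigma> V"

abbreviation ground_terms :: "(nat \<Rightarrow> 'f set) \<Rightarrow> ('f, 'v) trm set" where
  "ground_terms \<Sigma> \<equiv> terms \<Sigma> {}"

text \<open>Positions are strings of positive integers: arguments are numbered from 1.\<close>

primrec pos :: "('f, 'v) trm \<Rightarrow> nat list set" where
  "pos (Var v) = {[]}"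
| "pos (Fun f ts) = {[]} \<union> (\<Union>i\<in>{1..length ts}. (#) i ` (map pos ts ! (i - 1)))"

text \<open>The next two functions are meaningful only for positions of the given term.\<close>

fun subt_at :: "('f, 'v) trm \<Rightarrow> nat list \<Rightarrow> ('f, 'v) trm" where
  "subt_at s [] = s"
| "subt_at (Fun f ts) (i # q) = subt_at (ts ! (i - 1)) q"

fun replace_at :: "('f, 'v) trm \<Rightarrow> nat list \<Rightarrow> ('f, 'v) trm \<Rightarrow> ('f, 'v) trm" where
  "replace_at s [] t = t"
| "replace_at (Fun f ts) (i # q) t = Fun f (ts[i - 1 := replace_at (ts ! (i - 1)) q t])"

text \<open>
  The substitutions over \<open>\<Sigma>\<close> and \<open>V\<close> are the elements of \<open>V \<rightarrow> terms \<Sigma> V\<close>; their values outside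
  \<open>V\<close> are irrelevant.
\<close>

primrec subst :: "('v \<Rightarrow> ('f, 'v) trm) \<Rightarrow> ('f, 'v) trm \<Rightarrow> ('f, 'v) trm" where
  "subst \<sigma> (Var v) = \<sigma> v"
| "subst \<sigma> (Fun f ts) = Fun f (map (subst \<sigma>) ts)"

section \<open>Rewriting functions\<close>

definition instances_at ::
  "(nat \<Rightarrow> 'f set) \<Rightarrow> 'v set \<Rightarrow> ('f, 'v) trm \<Rightarrow> nat list \<Rightarrow> ('f, 'v) trm set" where
  "instances_at \<Sigma> V s p =
     {t \<in> terms \<Sigma> V. p \<in> pos t \<and> (\<exists>\<sigma> \<in> V \<rightarrow> terms \<Sigma> V. subt_at t p = subst \<sigma> s)}"

definition rewriting_fun ::
  "(nat \<Rightarrow> 'f set) \<Rightarrow> 'v set \<Rightarrow> ('f, 'v) trm \<Rightarrow> ('f, 'v) trm \<Rightarrow> nat list \<Rightarrow> ('f, 'v) trm \<Rightarrow> ('f, 'v) trm"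
  where
  "rewriting_fun \<Sigma> V l r p =
     (\<lambda>t \<in> instances_at \<Sigma> V l p.
        THE u. \<exists>\<sigma> \<in> V \<rightarrow> terms \<Sigma> V. subt_at t p = subst \<sigma> l \<and> u = replace_at t p (subst \<sigma> r))"

lemma subst_eq_iff: "subst \<sigma> s = subst \<sigma>' s \<longleftrightarrow> (\<forall>v \<in> vars s. \<sigma> v = \<sigma>' v)"
  by (induction s) auto

text \<open>The description operator above is justified: the result does not depend on \<open>\<sigma>\<close>.\<close>

lemma rewriting_fun_eq:
  assumes "t \<in> terms \<Sigma> V" "p \<in> pos t" "\<sigma> \<in> V \<rightarrow> terms \<Sigma> V" "subt_at t p = subst \<sigma> l"
    and "vars r \<subseteq> vars l"
  shows "rewriting_fun \<Sigma> V l r p t = replace_at t p (subst \<sigma> r)"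
proof -
  have *: "subst \<sigma>' r = subst \<sigma> r" if "subt_at t p = subst \<sigma>' l" for \<sigma>'
    using that assms(4,5) by (metis subst_eq_iff subsetD)
  have "t \<in> instances_at \<Sigma> V l p"
    using assms by (auto simp: instances_at_def)
  moreover have "(THE u. \<exists>\<sigma> \<in> V \<rightarrow> terms \<Sigma> V. subt_at t p = subst \<sigma> l \<and> u = replace_at t p (subst \<sigma> r))
      = replace_at t p (subst \<sigma> r)"
  proof (rule the_equality)
    show "\<exists>\<sigma>' \<in> V \<rightarrow> terms \<Sigma> V. subt_at t p = subst \<sigma>' l \<and>
        replace_at t p (subst \<sigma> r) = replace_at t p (subst \<sigma>' r)"
      using assms(3,4) by blast
  qed (metis *)
  ultimately show ?thesis
    by (simp add: rewriting_fun_def)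
qed

section \<open>Algebras\<close>

text \<open>
  \<open>X\<^sup>n\<close> is represented by \<open>nlists n X\<close>. The operation \<open>c n f\<close> interprets \<open>f\<close> as an element of
  \<open>\<Sigma> n\<close>. Functions between sets are extensional (\<open>\<rightarrow>\<^sub>E\<close>, \<open>\<Pi>\<^sub>E\<close>), so that HOL equality is equality
  of functions on the given domain.
\<close>

definition algebra_on ::
  "(nat \<Rightarrow> 'f set) \<Rightarrow> 'x set \<Rightarrow> (nat \<Rightarrow> 'f \<Rightarrow> 'x list \<Rightarrow> 'x) \<Rightarrow> bool" where
  "algebra_on \<Sigma> X c \<longleftrightarrow> (\<forall>n. c n \<in> (\<Pi>\<^sub>E f \<in> \<Sigma> n. nlists n X \<rightarrow>\<^sub>E X))"

text \<open>The catamorphism is only used on ground terms.\<close>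

primrec cata :: "(nat \<Rightarrow> 'f \<Rightarrow> 'x list \<Rightarrow> 'x) \<Rightarrow> ('f, 'v) trm \<Rightarrow> 'x" where
  "cata c (Var v) = undefined"
| "cata c (Fun f ts) = c (length ts) f (map (cata c) ts)"

section \<open>Rewriting models\<close>

text \<open>
  The types \<open>'f\<close> and \<open>'v\<close> are only the universes from which the signature and the set of variables
  of a model are drawn; both may be arbitrary subsets. The condition that \<open>V\<close> is disjoint from
  \<open>\<Sigma>\<close> is built into the datatype of terms.
\<close>

record ('f, 'v, 'x) rewriting_model =
  rm_out :: "'x set"
  rm_sig :: "nat \<Rightarrow> 'f set"
  rm_vars :: "'v set"
  rm_lhs :: "('f, 'v) trm"
  rm_rhs :: "('f, 'v) trm"
  rm_pos :: "nat list"
  rm_alg :: "nat \<Rightarrow> 'f \<Rightarrow> 'x list \<Rightarrow> 'x"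
  rm_init :: "('f, 'v) trm"

definition is_rewriting_model :: "('f, 'v, 'x) rewriting_model \<Rightarrow> bool" where
  "is_rewriting_model M \<longleftrightarrow>
     rm_lhs M \<in> terms (rm_sig M) (rm_vars M) \<and>
     rm_rhs M \<in> terms (rm_sig M) (rm_vars M) \<and>
     vars (rm_rhs M) \<subseteq> vars (rm_lhs M) \<and>
     (\<exists>\<tau> \<in> rm_vars M \<rightarrow> terms (rm_sig M) (rm_vars M). rm_rhs M = subst \<tau> (rm_lhs M)) \<and>
     algebra_on (rm_sig M) (rm_out M) (rm_alg M) \<and>
     rm_init M \<in> ground_terms (rm_sig M) \<and>
     rm_init M \<in> instances_at (rm_sig M) (rm_vars M) (rm_lhs M) (rm_pos M)"

definition rm_seq :: "('f, 'v, 'x) rewriting_model \<Rightarrow> nat \<Rightarrow> 'x" where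
  "rm_seq M n =
     cata (rm_alg M)
       ((rewriting_fun (rm_sig M) (rm_vars M) (rm_lhs M) (rm_rhs M) (rm_pos M) ^^ n) (rm_init M))"

section \<open>Cartesian dynamical systems\<close>

record 'x cartesian_system =
  cs_out :: "'x set"
  cs_dim :: nat
  cs_step :: "'x list \<Rightarrow> 'x list"
  cs_obs :: "'x list \<Rightarrow> 'x"
  cs_init :: "'x list"

definition is_cartesian_system :: "'x cartesian_system \<Rightarrow> bool" where
  "is_cartesian_system D \<longleftrightarrow>
     cs_step D \<in> nlists (cs_dim D) (cs_out D) \<rightarrow>\<^sub>E nlists (cs_dim D) (cs_out D) \<and>
     cs_obs D \<in> nlists (cs_dim D) (cs_out D) \<rightarrow>\<^sub>E cs_out D \<and>
     cs_init D \<in> nlists (cs_dim D) (cs_out D)"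

definition cs_seq :: "'x cartesian_system \<Rightarrow> nat \<Rightarrow> 'x" where
  "cs_seq D n = cs_obs D ((cs_step D ^^ n) (cs_init D))"

end

theory Submission
  imports Defs
begin

text \<open>
  A rewriting step at \<open>p\<close> with \<open>r = \<tau> l\<close> only ever changes the instantiation of the variables of
  \<open>l\<close>: from \<open>t\<^sub>0[\<sigma> l]\<^sub>p\<close> it leads to \<open>t\<^sub>0[\<sigma> (\<tau> l)]\<^sub>p\<close>, so the substitution \<open>\<sigma>\<close> is replaced by
  \<open>\<sigma> \<circ> \<tau>\<close> while the context \<open>t\<^sub>0[ ]\<^sub>p\<close> stays the same. Under the catamorphism, \<open>\<sigma>\<close> becomes a
  valuation of the variables of \<open>l\<close> in \<open>X\<close>, that is, a point of \<open>X\<^sup>d\<close> once the \<open>d\<close> variables of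
  \<open>l\<close> are listed; evaluation commutes with substitution (\<open>eval_subst\<close>), so the new valuation is a
  function of the old one, and the output is the value of the open term \<open>t\<^sub>0[l]\<^sub>p\<close>. This is the
  cartesian system \<open>project M\<close>: its state map evaluates the terms \<open>\<tau> v\<close>, its output map evaluates
  \<open>t\<^sub>0[l]\<^sub>p\<close>, and its initial state consists of the values of the subterms of \<open>t\<^sub>0\<close> matched by the
  variables (\<open>cs_seq_project\<close>).

  Conversely, a map \<open>G\<close> on \<open>X\<^sup>d\<close> is a tuple of \<open>d\<close> operations \<open>G\<^sub>1, \<dots>, G\<^sub>d\<close> of arity \<open>d\<close>. The
  model \<open>section_model\<close> has these operations, the output map \<open>f\<close> and the \<open>d\<close> coordinates of
  \<open>y\<^sub>0\<close> as its operators, and rewrites \<open>f(v\<^sub>1, \<dots>, v\<^sub>d)\<close> to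
  \<open>f(G\<^sub>1(v\<^sub>1, \<dots>, v\<^sub>d), \<dots>, G\<^sub>d(v\<^sub>1, \<dots>, v\<^sub>d))\<close> at the root. Reading off state map, output map and initial
  state from these terms gives back \<open>G\<close>, \<open>f\<close> and \<open>y\<^sub>0\<close> (\<open>project_section_model\<close>). That the section
  preserves the generated sequence is then a consequence of the same property of the projection.
  Infinite universes of operators and variables serve all \<open>d\<close> at once: the model
  uses \<open>2 d + 1\<close> distinct operators and \<open>d\<close> distinct variables.
\<close>

section \<open>Terms, positions and substitutions\<close>

lemma vars_subset_if_terms: "t \<in> terms \<Sigma> V \<Longrightarrow> vars t \<subseteq> V"
  by (induction rule: terms.induct) auto

lemma terms_change_vars: "t \<in> terms \<Sigma> V \<Longrightarrow> vars t \<subseteq> W \<Longrightarrow> t \<in> terms \<Sigma> W"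
  by (induction rule: terms.induct) (auto intro!: terms.intros)

lemma terms_mono: "V \<subseteq> W \<Longrightarrow> terms \<Sigma> V \<subseteq> terms \<Sigma> W"
  using terms_change_vars vars_subset_if_terms by blast

lemma Fun_in_terms_iff:
  "Fun f ts \<in> terms \<Sigma> V \<longleftrightarrow> f \<in> \<Sigma> (length ts) \<and> (\<forall>t\<in>set ts. t \<in> terms \<Sigma> V)"
  by (subst terms.simps) auto

lemma subst_in_terms:
  "s \<in> terms \<Sigma> V \<Longrightarrow> \<sigma> \<in> V \<rightarrow> terms \<Sigma> W \<Longrightarrow> subst \<sigma> s \<in> terms \<Sigma> W"
  by (induction rule: terms.induct) (auto intro!: terms.intros)

lemma subst_image_in_terms:
  "subst \<sigma> s \<in> terms \<Sigma> V \<Longrightarrow> v \<in> vars s \<Longrightarrow> \<sigma> v \<in> terms \<Sigma> V"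
  by (induction s) (auto simp: Fun_in_terms_iff)

lemma subst_subst: "subst \<sigma> (subst \<tau> s) = subst (\<lambda>v. subst \<sigma> (\<tau> v)) s"
  by (induction s) auto

lemma subst_ground: "vars s = {} \<Longrightarrow> subst \<sigma> s = s"
  by (induction s) (auto intro!: map_idI)

lemma Nil_in_pos: "[] \<in> pos t"
  by (cases t) auto

lemma Cons_in_pos_Fun_iff:
  "i # q \<in> pos (Fun f ts) \<longleftrightarrow> 1 \<le> i \<and> i \<le> length ts \<and> q \<in> pos (ts ! (i - 1))"
  by (auto simp: image_iff)

lemma subt_at_replace_at: "p \<in> pos t \<Longrightarrow> subt_at (replace_at t p u) p = u"
  by (induction t p rule: subt_at.induct) (auto simp: Cons_in_pos_Fun_iff simp del: pos.simps(2))

lemma replace_at_replace_at: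
  "p \<in> pos t \<Longrightarrow> replace_at (replace_at t p u) p w = replace_at t p w"
  by (induction t p rule: subt_at.induct) (auto simp: Cons_in_pos_Fun_iff simp del: pos.simps(2))

lemma replace_at_subt_at: "p \<in> pos t \<Longrightarrow> replace_at t p (subt_at t p) = t"
  by (induction t p rule: subt_at.induct) (auto simp: Cons_in_pos_Fun_iff simp del: pos.simps(2))

lemma pos_replace_at: "p \<in> pos t \<Longrightarrow> p \<in> pos (replace_at t p u)"
  by (induction t p rule: subt_at.induct)
    (auto simp: Nil_in_pos Cons_in_pos_Fun_iff simp del: pos.simps(2))

lemma subt_at_in_terms: "p \<in> pos t \<Longrightarrow> t \<in> terms \<Sigma> V \<Longrightarrow> subt_at t p \<in> terms \<Sigma> V"
  by (induction t p rule: subt_at.induct)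
    (auto simp: Cons_in_pos_Fun_iff Fun_in_terms_iff simp del: pos.simps(2))

lemma replace_at_in_terms:
  "p \<in> pos t \<Longrightarrow> t \<in> terms \<Sigma> V \<Longrightarrow> u \<in> terms \<Sigma> V \<Longrightarrow> replace_at t p u \<in> terms \<Sigma> V"
  by (induction t p rule: subt_at.induct)
    (auto simp: Cons_in_pos_Fun_iff Fun_in_terms_iff simp del: pos.simps(2)
      dest!: set_update_subset_insert[THEN subsetD])

lemma subst_replace_at:
  "p \<in> pos t \<Longrightarrow> subst \<sigma> (replace_at t p u) = replace_at (subst \<sigma> t) p (subst \<sigma> u)"
  by (induction t p rule: subt_at.induct)
    (auto simp: Cons_in_pos_Fun_iff map_update simp del: pos.simps(2))

primrec var_list :: "('f, 'v) trm \<Rightarrow> 'v list" where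
  "var_list (Var v) = [v]"
| "var_list (Fun f ts) = concat (map var_list ts)"

lemma set_var_list: "set (var_list t) = vars t"
  by (induction t) auto

text \<open>
  No domain is imposed on the substitution: on the variables of \<open>s\<close> it is determined by \<open>s\<close> and
  \<open>t\<close>, and its other values never matter.
\<close>

definition matcher :: "('f, 'v) trm \<Rightarrow> ('f, 'v) trm \<Rightarrow> 'v \<Rightarrow> ('f, 'v) trm" where
  "matcher s t = (SOME \<sigma>. t = subst \<sigma> s)"

lemma matcher_eq:
  assumes "t = subst \<sigma> s" "v \<in> vars s"
  shows "matcher s t v = \<sigma> v"
  using someI[of "\<lambda>\<sigma>. t = subst \<sigma> s", OF assms(1)] assms
  by (auto simp: matcher_def subst_eq_iff)

section \<open>Evaluation of open terms\<close>

primrec eval_trm :: "(nat \<Rightarrow> 'f \<Rightarrow> 'x list \<Rightarrow> 'x) \<Rightarrow> ('v \<Rightarrow> 'x) \<Rightarrow> ('f, 'v) trm \<Rightarrow> 'x" where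
  "eval_trm c \<alpha> (Var v) = \<alpha> v"
| "eval_trm c \<alpha> (Fun f ts) = c (length ts) f (map (eval_trm c \<alpha>) ts)"

lemma eval_trm_cong: "(\<And>v. v \<in> vars t \<Longrightarrow> \<alpha> v = \<beta> v) \<Longrightarrow> eval_trm c \<alpha> t = eval_trm c \<beta> t"
proof (induction t)
  case (Fun f ts)
  then have "map (eval_trm c \<alpha>) ts = map (eval_trm c \<beta>) ts"
    by (intro map_cong) auto
  then show ?case
    by (simp only: eval_trm.simps)
qed simp

text \<open>
  Composing with a substitution acts on valuations by \<open>\<alpha> \<mapsto> eval_trm c \<alpha> \<circ> \<sigma>\<close>. This is what turns
  the composition of substitutions, performed by rewriting, into the iteration of a map on \<open>X\<^sup>d\<close>.
\<close>

lemma eval_subst: "eval_trm c \<alpha> (subst \<sigma> t) = eval_trm c (\<lambda>v. eval_trm c \<alpha> (\<sigma> v)) t"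
  by (induction t) (auto simp: o_def cong: map_cong)

lemma cata_eq_eval: "cata c t = eval_trm c (\<lambda>_. undefined) t"
  by (induction t) (auto simp: o_def cong: map_cong)

lemma cata_subst: "cata c (subst \<sigma> t) = eval_trm c (\<lambda>v. cata c (\<sigma> v)) t"
  by (simp add: cata_eq_eval eval_subst)

lemma eval_in_algebra:
  assumes "algebra_on \<Sigma> X c" "\<alpha> \<in> V \<rightarrow> X"
  shows "t \<in> terms \<Sigma> V \<Longrightarrow> eval_trm c \<alpha> t \<in> X"
proof (induction rule: terms.induct)
  case (Fun f ts)
  have args: "map (eval_trm c \<alpha>) ts \<in> nlists (length ts) X"
    using Fun.IH by (intro nlistsI) auto
  have "c (length ts) f \<in> nlists (length ts) X \<rightarrow>\<^sub>E X"
    using PiE_mem[OF assms(1)[unfolded algebra_on_def, rule_format] Fun(1)] .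
  then have "c (length ts) f (map (eval_trm c \<alpha>) ts) \<in> X"
    using args by (rule PiE_mem)
  then show ?case
    by simp
next
  case (Var v)
  then show ?case
    using assms(2) by auto
qed

lemma cata_in_algebra: "algebra_on \<Sigma> X c \<Longrightarrow> t \<in> ground_terms \<Sigma> \<Longrightarrow> cata c t \<in> X"
  unfolding cata_eq_eval by (erule eval_in_algebra) simp_all

section \<open>From rewriting models to cartesian systems\<close>

definition valuation :: "'v list \<Rightarrow> 'x list \<Rightarrow> 'v \<Rightarrow> 'x" where
  "valuation vs y v = the (map_of (zip vs y) v)"

lemma valuation_map: "v \<in> set vs \<Longrightarrow> valuation vs (map h vs) v = h v"
  by (simp add: valuation_def map_of_zip_map)

lemma map_valuation: "distinct vs \<Longrightarrow> length vs = length y \<Longrightarrow> map (valuation vs y) vs = y"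
  by (rule nth_equalityI) (auto simp: valuation_def map_of_zip_nth)

lemma valuation_in:
  assumes "distinct vs" "y \<in> nlists (length vs) X"
  shows "valuation vs y \<in> set vs \<rightarrow> X"
proof
  fix v assume "v \<in> set vs"
  then have "valuation vs y v \<in> set (map (valuation vs y) vs)"
    by simp
  also have "map (valuation vs y) vs = y"
    using assms by (intro map_valuation) simp_all
  finally show "valuation vs y v \<in> X"
    using nlistsE_set[OF assms(2)] by blast
qed

definition rm_var_list :: "('f, 'v, 'x) rewriting_model \<Rightarrow> 'v list" where
  "rm_var_list M = remdups (var_list (rm_lhs M))"

text \<open>
  The variables are those occurring in \<open>l\<close> rather than all of \<open>V\<close>, which may be infinite. A
  fixed order of occurrence serves as their enumeration, so that the coordinates of the states come
  in the intended order when \<open>l\<close> is \<open>f(v\<^sub>1, \<dots>, v\<^sub>d)\<close>.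
\<close>

definition project :: "('f, 'v, 'x) rewriting_model \<Rightarrow> 'x cartesian_system" where
  "project M =
    (let vs = rm_var_list M; Y = nlists (length vs) (rm_out M) in
     \<lparr>cs_out = rm_out M,
      cs_dim = length vs,
      cs_step = (\<lambda>y\<in>Y. map (\<lambda>v. eval_trm (rm_alg M) (valuation vs y)
                              (matcher (rm_lhs M) (rm_rhs M) v)) vs),
      cs_obs = (\<lambda>y\<in>Y. eval_trm (rm_alg M) (valuation vs y)
                              (replace_at (rm_init M) (rm_pos M) (rm_lhs M))),
      cs_init = map (\<lambda>v. cata (rm_alg M)
                     (matcher (rm_lhs M) (subt_at (rm_init M) (rm_pos M)) v)) vs\<rparr>)"

lemma project_simps:
  "cs_out (project M) = rm_out M"
  "cs_dim (project M) = length (rm_var_list M)"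
  "cs_step (project M) =
    (\<lambda>y\<in>nlists (length (rm_var_list M)) (rm_out M).
      map (\<lambda>v. eval_trm (rm_alg M) (valuation (rm_var_list M) y)
                 (matcher (rm_lhs M) (rm_rhs M) v)) (rm_var_list M))"
  "cs_obs (project M) =
    (\<lambda>y\<in>nlists (length (rm_var_list M)) (rm_out M).
      eval_trm (rm_alg M) (valuation (rm_var_list M) y)
        (replace_at (rm_init M) (rm_pos M) (rm_lhs M)))"
  "cs_init (project M) =
    map (\<lambda>v. cata (rm_alg M) (matcher (rm_lhs M) (subt_at (rm_init M) (rm_pos M)) v))
      (rm_var_list M)"
  by (simp_all add: project_def Let_def)

lemma set_rm_var_list: "set (rm_var_list M) = vars (rm_lhs M)"
  by (simp add: rm_var_list_def set_var_list)

lemma distinct_rm_var_list: "distinct (rm_var_list M)"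
  by (simp add: rm_var_list_def)

lemma is_cartesian_system_project:
  fixes M :: "('f, 'v, 'x) rewriting_model"
  assumes "is_rewriting_model M"
  shows "is_cartesian_system (project M)"
proof -
  let ?\<Sigma> = "rm_sig M" and ?X = "rm_out M" and ?c = "rm_alg M" and ?l = "rm_lhs M"
    and ?vs = "rm_var_list M"
  let ?Y = "nlists (length ?vs) ?X"
  have alg: "algebra_on ?\<Sigma> ?X ?c" and ground: "rm_init M \<in> ground_terms ?\<Sigma>"
    and p: "rm_pos M \<in> pos (rm_init M)"
    using assms by (auto simp: is_rewriting_model_def instances_at_def)
  obtain \<sigma> \<tau> where \<sigma>: "subt_at (rm_init M) (rm_pos M) = subst \<sigma> ?l"
    and \<tau>: "rm_rhs M = subst \<tau> ?l"
    using assms by (auto simp: is_rewriting_model_def instances_at_def)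
  have l: "?l \<in> terms ?\<Sigma> (vars ?l)" and r: "rm_rhs M \<in> terms ?\<Sigma> (vars ?l)"
    using assms by (auto simp: is_rewriting_model_def intro: terms_change_vars)
  have val: "valuation ?vs y \<in> vars ?l \<rightarrow> ?X" if "y \<in> ?Y" for y
    using valuation_in[OF distinct_rm_var_list that] by (simp add: set_rm_var_list)
  have "cs_step (project M) \<in> ?Y \<rightarrow>\<^sub>E ?Y"
  proof -
    have "matcher ?l (rm_rhs M) v \<in> terms ?\<Sigma> (vars ?l)" if "v \<in> vars ?l" for v
      using subst_image_in_terms[of \<tau> ?l] r \<tau> matcher_eq[OF \<tau> that] that by simp
    then show ?thesis
      by (auto simp: project_simps set_rm_var_list
          intro!: nlistsI eval_in_algebra[OF alg val])
  qed
  moreover have "cs_obs (project M) \<in> ?Y \<rightarrow>\<^sub>E ?X"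
  proof -
    have "replace_at (rm_init M) (rm_pos M) ?l \<in> terms ?\<Sigma> (vars ?l)"
      using p ground l terms_mono[of "{}" "vars ?l"] by (blast intro: replace_at_in_terms)
    then show ?thesis
      by (auto simp: project_simps intro!: eval_in_algebra[OF alg val])
  qed
  moreover have "cs_init (project M) \<in> ?Y"
  proof -
    have "matcher ?l (subt_at (rm_init M) (rm_pos M)) v \<in> ground_terms ?\<Sigma>"
      if "v \<in> vars ?l" for v
      using subst_image_in_terms[of \<sigma> ?l] subt_at_in_terms[OF p ground] \<sigma> matcher_eq[OF \<sigma> that]
        that by simp
    then show ?thesis
      by (auto simp: project_simps set_rm_var_list
          intro!: nlistsI cata_in_algebra[OF alg])
  qed
  ultimately show ?thesis
    by (simp add: is_cartesian_system_def project_simps(1,2))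
qed

text \<open>
  Both orbits are described by the substitutions \<open>\<sigma> \<circ> \<tau>\<^sup>n\<close>: the rewritten term is \<open>t\<^sub>0\<close> with the
  instance of \<open>l\<close> plugged in at \<open>p\<close>, and the state of the cartesian system is the list of values of
  that substitution.
\<close>

lemma cs_seq_project:
  fixes M :: "('f, 'v, 'x) rewriting_model"
  assumes "is_rewriting_model M"
  shows "cs_seq (project M) = rm_seq M"
proof
  fix n
  let ?\<Sigma> = "rm_sig M" and ?V = "rm_vars M" and ?X = "rm_out M" and ?c = "rm_alg M"
    and ?l = "rm_lhs M" and ?r = "rm_rhs M" and ?p = "rm_pos M" and ?t0 = "rm_init M"
    and ?vs = "rm_var_list M"
  have l: "?l \<in> terms ?\<Sigma> ?V" and vr: "vars ?r \<subseteq> vars ?l"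
    and ground: "?t0 \<in> ground_terms ?\<Sigma>"
    and t0: "?t0 \<in> terms ?\<Sigma> ?V" and p: "?p \<in> pos ?t0"
    using assms by (auto simp: is_rewriting_model_def instances_at_def)
  obtain \<sigma> where \<sigma>: "subt_at ?t0 ?p = subst \<sigma> ?l" "\<sigma> \<in> ?V \<rightarrow> terms ?\<Sigma> ?V"
    using assms by (auto simp: is_rewriting_model_def instances_at_def)
  obtain \<tau> where \<tau>: "?r = subst \<tau> ?l" "\<tau> \<in> ?V \<rightarrow> terms ?\<Sigma> ?V"
    using assms by (auto simp: is_rewriting_model_def)
  define \<rho> where "\<rho> n = ((\<lambda>\<rho> v. subst \<rho> (\<tau> v)) ^^ n) \<sigma>" for n
  have \<rho>_simps: "\<rho> 0 = \<sigma>" "\<rho> (Suc n) = (\<lambda>v. subst (\<rho> n) (\<tau> v))" for n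
    by (auto simp: \<rho>_def)
  have \<rho>_terms: "\<rho> n \<in> ?V \<rightarrow> terms ?\<Sigma> ?V" for n
  proof (induction n)
    case (Suc n)
    then show ?case
      using \<tau>(2) by (auto simp: \<rho>_simps intro!: subst_in_terms)
  qed (use \<sigma>(2) in \<open>simp add: \<rho>_simps\<close>)
  have rewrite: "(rewriting_fun ?\<Sigma> ?V ?l ?r ?p ^^ n) ?t0 = replace_at ?t0 ?p (subst (\<rho> n) ?l)" for n
  proof (induction n)
    case 0
    then show ?case
      using replace_at_subt_at[OF p] by (simp add: \<sigma> \<rho>_simps)
  next
    case (Suc n)
    let ?u = "replace_at ?t0 ?p (subst (\<rho> n) ?l)"
    have "rewriting_fun ?\<Sigma> ?V ?l ?r ?p ?u = replace_at ?u ?p (subst (\<rho> n) ?r)"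
      using p t0 vr l \<rho>_terms
      by (intro rewriting_fun_eq)
        (auto intro!: replace_at_in_terms subst_in_terms simp: pos_replace_at subt_at_replace_at)
    also have "\<dots> = replace_at ?t0 ?p (subst (\<rho> (Suc n)) ?l)"
      by (simp add: replace_at_replace_at[OF p] \<tau>(1) subst_subst \<rho>_simps)
    finally show ?case
      by (simp add: Suc)
  qed
  have project: "is_cartesian_system (project M)"
    by (rule is_cartesian_system_project[OF assms])
  define a where "a n = map (\<lambda>v. cata ?c (\<rho> n v)) ?vs" for n
  have a_valuation: "valuation ?vs (a n) v = cata ?c (\<rho> n v)" if "v \<in> vars ?l" for n v
    using that by (simp add: a_def valuation_map set_rm_var_list)
  have step: "(cs_step (project M) ^^ n) (cs_init (project M)) = a n
      \<and> a n \<in> nlists (length ?vs) ?X" for n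
  proof (induction n)
    case 0
    have "cs_init (project M) = a 0"
      by (auto simp: project_simps a_def \<rho>_simps set_rm_var_list matcher_eq[OF \<sigma>(1)])
    then show ?case
      using project by (simp add: is_cartesian_system_def project_simps(1,2))
  next
    case (Suc n)
    have "eval_trm ?c (valuation ?vs (a n)) (\<tau> v) = cata ?c (\<rho> (Suc n) v)"
      if v: "v \<in> vars ?l" for v
    proof -
      \<comment> \<open>All variables of \<open>\<tau> v\<close> occur in \<open>\<tau> l = r\<close>, hence are coordinates of the state.\<close>
      have "vars (\<tau> v) \<subseteq> vars ?l"
        using vr v unfolding \<tau>(1)
        by (metis subst_image_in_terms terms_change_vars vars_subset_if_terms l \<tau>(1,2)
            subst_in_terms)
      then have "eval_trm ?c (valuation ?vs (a n)) (\<tau> v) = eval_trm ?c (\<lambda>w. cata ?c (\<rho> n w)) (\<tau> v)"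
        by (intro eval_trm_cong a_valuation) auto
      then show ?thesis
        by (simp add: \<rho>_simps cata_subst)
    qed
    then have "cs_step (project M) (a n) = a (Suc n)"
      using Suc by (auto simp: project_simps a_def[of "Suc n"] set_rm_var_list matcher_eq[OF \<tau>(1)])
    moreover have "cs_step (project M) (a n) \<in> nlists (length ?vs) ?X"
      using Suc project by (auto simp: is_cartesian_system_def project_simps(1,2))
    ultimately show ?case
      using Suc by simp
  qed
  have ground_vars: "vars ?t0 = {}"
    using vars_subset_if_terms[OF ground] by simp
  have vars_context: "vars (replace_at ?t0 ?p ?l) \<subseteq> vars ?l"
  proof (rule vars_subset_if_terms[where \<Sigma> = ?\<Sigma>], rule replace_at_in_terms[OF p])
    show "?t0 \<in> terms ?\<Sigma> (vars ?l)"
      using ground terms_mono by blast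
    show "?l \<in> terms ?\<Sigma> (vars ?l)"
      using l by (rule terms_change_vars) simp
  qed
  have "cs_seq (project M) n = eval_trm ?c (valuation ?vs (a n)) (replace_at ?t0 ?p ?l)"
    using step[of n] by (simp add: cs_seq_def project_simps(4))
  also have "\<dots> = eval_trm ?c (\<lambda>v. cata ?c (\<rho> n v)) (replace_at ?t0 ?p ?l)"
    using vars_context by (intro eval_trm_cong a_valuation) auto
  also have "\<dots> = cata ?c (subst (\<rho> n) (replace_at ?t0 ?p ?l))"
    by (simp add: cata_subst)
  \<comment> \<open>The context is ground, so the substitution only reaches the copy of \<open>l\<close>.\<close>
  also have "subst (\<rho> n) (replace_at ?t0 ?p ?l) = replace_at ?t0 ?p (subst (\<rho> n) ?l)"
    by (simp add: subst_replace_at[OF p] subst_ground[OF ground_vars])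
  also have "cata ?c \<dots> = rm_seq M n"
    by (simp add: rm_seq_def rewrite)
  finally show "cs_seq (project M) n = rm_seq M n" .
qed

section \<open>From cartesian systems to rewriting models\<close>

text \<open>
  The operators are \<open>e 0, \<dots>, e (2 * d)\<close> for an injection \<open>e\<close>: the first \<open>d\<close> are the coordinates of
  the state map, \<open>e d\<close> is the output map, and the last \<open>d\<close> are the constants for the initial
  state. The index alone tells which operation an operator denotes, whatever its arity.
\<close>

definition section_sig :: "(nat \<Rightarrow> 'f) \<Rightarrow> nat \<Rightarrow> nat \<Rightarrow> 'f set" where
  "section_sig e d n = e ` {j. j \<le> d \<and> n = d \<or> d < j \<and> j \<le> 2 * d \<and> n = 0}"

definition section_op :: "'x cartesian_system \<Rightarrow> nat \<Rightarrow> 'x list \<Rightarrow> 'x" where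
  "section_op D j xs =
    (if j < cs_dim D then cs_step D xs ! j
     else if j = cs_dim D then cs_obs D xs
     else cs_init D ! (j - Suc (cs_dim D)))"

definition section_vars :: "(nat \<Rightarrow> 'v) \<Rightarrow> nat \<Rightarrow> ('f, 'v) trm list" where
  "section_vars w d = map (\<lambda>i. Var (w i)) [0..<d]"

definition section_model ::
  "(nat \<Rightarrow> 'f) \<Rightarrow> (nat \<Rightarrow> 'v) \<Rightarrow> 'x cartesian_system \<Rightarrow> ('f, 'v, 'x) rewriting_model" where
  "section_model e w D =
    (let d = cs_dim D in
     \<lparr>rm_out = cs_out D,
      rm_sig = section_sig e d,
      rm_vars = w ` {..<d},
      rm_lhs = Fun (e d) (section_vars w d),
      rm_rhs = Fun (e d) (map (\<lambda>i. Fun (e i) (section_vars w d)) [0..<d]),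
      rm_pos = [],
      rm_alg = (\<lambda>n. \<lambda>f\<in>section_sig e d n. \<lambda>xs\<in>nlists n (cs_out D). section_op D (inv e f) xs),
      rm_init = Fun (e d) (map (\<lambda>i. Fun (e (Suc d + i)) []) [0..<d])\<rparr>)"

lemma section_model_simps:
  "rm_out (section_model e w D) = cs_out D"
  "rm_sig (section_model e w D) = section_sig e (cs_dim D)"
  "rm_vars (section_model e w D) = w ` {..<cs_dim D}"
  "rm_lhs (section_model e w D) = Fun (e (cs_dim D)) (section_vars w (cs_dim D))"
  "rm_rhs (section_model e w D) =
    Fun (e (cs_dim D)) (map (\<lambda>i. Fun (e i) (section_vars w (cs_dim D))) [0..<cs_dim D])"
  "rm_pos (section_model e w D) = []"
  "rm_alg (section_model e w D) =
    (\<lambda>n. \<lambda>f\<in>section_sig e (cs_dim D) n. \<lambda>xs\<in>nlists n (cs_out D). section_op D (inv e f) xs)"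
  "rm_init (section_model e w D) =
    Fun (e (cs_dim D)) (map (\<lambda>i. Fun (e (Suc (cs_dim D) + i)) []) [0..<cs_dim D])"
  by (simp_all add: section_model_def Let_def)

lemma section_sigI:
  "j \<le> d \<Longrightarrow> e j \<in> section_sig e d d"
  "i < d \<Longrightarrow> e (Suc d + i) \<in> section_sig e d 0"
  by (auto simp: section_sig_def)

lemma section_vars_in_terms: "set (section_vars w d) \<subseteq> terms \<Sigma> (w ` {..<d})"
  by (auto simp: section_vars_def intro!: terms.intros)

lemma length_section_vars [simp]: "length (section_vars w d) = d"
  by (simp add: section_vars_def)

lemma vars_section_vars: "vars (Fun f (section_vars w d)) = w ` {..<d}"
  by (auto simp: section_vars_def)

lemma subst_section_vars:
  assumes "inj w"
  shows "subst (\<lambda>v. h (inv w v)) (Fun f (section_vars w d)) = Fun f (map h [0..<d])"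
  using assms by (simp add: section_vars_def)

lemma section_op_in:
  assumes "is_cartesian_system D" "xs \<in> nlists n (cs_out D)"
    and "j \<le> cs_dim D \<and> n = cs_dim D \<or> cs_dim D < j \<and> j \<le> 2 * cs_dim D \<and> n = 0"
  shows "section_op D j xs \<in> cs_out D"
proof -
  have G: "cs_step D \<in> nlists (cs_dim D) (cs_out D) \<rightarrow>\<^sub>E nlists (cs_dim D) (cs_out D)"
    and f: "cs_obs D \<in> nlists (cs_dim D) (cs_out D) \<rightarrow>\<^sub>E cs_out D"
    and y0: "cs_init D \<in> nlists (cs_dim D) (cs_out D)"
    using assms(1) by (simp_all add: is_cartesian_system_def)
  consider "j < cs_dim D" "n = cs_dim D" | "j = cs_dim D" "n = cs_dim D"
    | "cs_dim D < j" "j \<le> 2 * cs_dim D"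
    using assms(3) by linarith
  then show ?thesis
  proof cases
    case 1
    then have "cs_step D xs \<in> nlists (cs_dim D) (cs_out D)"
      using PiE_mem[OF G] assms(2) by simp
    then show ?thesis
      using 1 by (simp add: section_op_def nlistsE_nth_in)
  next
    case 2
    then show ?thesis
      using PiE_mem[OF f] assms(2) by (simp add: section_op_def)
  next
    case 3
    then have "cs_init D ! (j - Suc (cs_dim D)) \<in> cs_out D"
      by (intro nlistsE_nth_in[OF y0]) auto
    then show ?thesis
      using 3 by (simp add: section_op_def)
  qed
qed

lemma algebra_on_section_model:
  assumes "inj e" "is_cartesian_system D"
  shows "algebra_on (section_sig e (cs_dim D)) (cs_out D) (rm_alg (section_model e w D))"
  unfolding algebra_on_def section_model_simps restrict_PiE_iff
proof (intro allI ballI)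
  fix n f xs assume "f \<in> section_sig e (cs_dim D) n" and xs: "xs \<in> nlists n (cs_out D)"
  then obtain j where f: "f = e j"
    and j: "j \<le> cs_dim D \<and> n = cs_dim D \<or> cs_dim D < j \<and> j \<le> 2 * cs_dim D \<and> n = 0"
    by (auto simp: section_sig_def)
  show "section_op D (inv e f) xs \<in> cs_out D"
    using section_op_in[OF assms(2) xs j] assms(1) by (simp add: f)
qed

lemma is_rewriting_model_section_model:
  fixes e :: "nat \<Rightarrow> 'f" and w :: "nat \<Rightarrow> 'v" and D :: "'x cartesian_system"
  assumes e: "inj e" and w: "inj w" and D: "is_cartesian_system D"
  shows "is_rewriting_model (section_model e w D)"
proof -
  define d where "d = cs_dim D"
  let ?M = "section_model e w D"
  let ?\<Sigma> = "section_sig e d" and ?V = "w ` {..<d}" and ?vs = "section_vars w d"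
  have l: "Fun (e i) ?vs \<in> terms ?\<Sigma> ?V" if "i \<le> d" for i
    using that section_vars_in_terms by (auto simp: Fun_in_terms_iff section_sigI)
  have const: "Fun (e (Suc (d + i))) [] \<in> terms ?\<Sigma> V" if "i < d" for i V
    using that section_sigI(2)[of i d e] by (auto simp: Fun_in_terms_iff)
  have init: "rm_init ?M \<in> terms ?\<Sigma> V" for V
    using const by (auto simp: section_model_simps d_def[symmetric] Fun_in_terms_iff section_sigI)
  have r: "rm_rhs ?M \<in> terms ?\<Sigma> ?V"
    using l by (auto simp: section_model_simps d_def[symmetric] section_sigI
        Fun_in_terms_iff[of "e d"])
  have "\<exists>\<tau>\<in>?V \<rightarrow> terms ?\<Sigma> ?V. rm_rhs ?M = subst \<tau> (rm_lhs ?M)"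
  proof
    show "(\<lambda>v. Fun (e (inv w v)) ?vs) \<in> ?V \<rightarrow> terms ?\<Sigma> ?V"
      using l w by auto
    show "rm_rhs ?M = subst (\<lambda>v. Fun (e (inv w v)) ?vs) (rm_lhs ?M)"
      using subst_section_vars[OF w, of "\<lambda>i. Fun (e i) ?vs"]
      by (simp add: section_model_simps d_def)
  qed
  moreover have "\<exists>\<sigma>\<in>?V \<rightarrow> terms ?\<Sigma> ?V. rm_init ?M = subst \<sigma> (rm_lhs ?M)"
  proof
    show "(\<lambda>v. Fun (e (Suc d + inv w v)) []) \<in> ?V \<rightarrow> terms ?\<Sigma> ?V"
      using const w by auto
    show "rm_init ?M = subst (\<lambda>v. Fun (e (Suc d + inv w v)) []) (rm_lhs ?M)"
      using subst_section_vars[OF w, of "\<lambda>i. Fun (e (Suc d + i)) []"]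
      by (simp add: section_model_simps d_def)
  qed
  moreover have "vars (rm_rhs ?M) \<subseteq> vars (rm_lhs ?M)"
    using vars_subset_if_terms[OF r]
    by (simp only: section_model_simps(4) vars_section_vars d_def)
  moreover have "algebra_on ?\<Sigma> (cs_out D) (rm_alg ?M)"
    unfolding d_def by (rule algebra_on_section_model[OF e D])
  moreover have "rm_lhs ?M \<in> terms ?\<Sigma> ?V"
    using l[of d] by (simp add: section_model_simps d_def)
  moreover have "[] \<in> pos (rm_init ?M)"
    by (simp add: section_model_simps)
  ultimately show ?thesis
    using init r
    by (simp add: is_rewriting_model_def instances_at_def section_model_simps(1,2,3,6) d_def)
qed

lemma rm_alg_section_model:
  assumes "inj e" "e j \<in> section_sig e (cs_dim D) n" "xs \<in> nlists n (cs_out D)"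
  shows "rm_alg (section_model e w D) n (e j) xs = section_op D j xs"
  using assms by (simp add: section_model_simps)

text \<open>
  The matching substitutions sending \<open>v\<^sub>i\<close> to \<open>G\<^sub>i(v\<^sub>1, \<dots>, v\<^sub>d)\<close> and to the \<open>i\<close>-th constant are
  forced, and the valuation belonging to \<open>y\<close> sends the argument list \<open>v\<^sub>1, \<dots>, v\<^sub>d\<close> back to \<open>y\<close>. So
  evaluation recovers each coordinate of \<open>G y\<close>. Equality of the maps themselves, not just on
  \<open>X\<^sup>d\<close>, uses that both are extensional.
\<close>

lemma project_section_model:
  fixes e :: "nat \<Rightarrow> 'f" and w :: "nat \<Rightarrow> 'v" and D :: "'x cartesian_system"
  assumes e: "inj e" and w: "inj w" and D: "is_cartesian_system D"
  shows "project (section_model e w D) = D"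
proof -
  define d where "d = cs_dim D"
  let ?M = "section_model e w D"
  let ?X = "cs_out D" and ?c = "rm_alg ?M" and ?vs = "map w [0..<d]"
  have G: "cs_step D \<in> nlists d ?X \<rightarrow>\<^sub>E nlists d ?X" and f: "cs_obs D \<in> nlists d ?X \<rightarrow>\<^sub>E ?X"
    and y0: "cs_init D \<in> nlists d ?X"
    using D by (auto simp: is_cartesian_system_def d_def)
  have dist: "distinct ?vs"
    by (simp add: distinct_map inj_on_subset[OF w])
  have "concat (map (\<lambda>i. [w i]) [0..<d]) = ?vs"
    by (induction d) auto
  then have vs: "rm_var_list ?M = ?vs"
    using dist by (simp add: rm_var_list_def section_model_simps(4) section_vars_def o_def
        d_def[symmetric] distinct_remdups_id)
  have vars_l: "w i \<in> vars (rm_lhs ?M)" if "i < d" for i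
    using that unfolding section_model_simps(4) vars_section_vars d_def by simp
  have \<tau>: "matcher (rm_lhs ?M) (rm_rhs ?M) (w i) = Fun (e i) (section_vars w d)" if "i < d" for i
  proof -
    have "rm_rhs ?M = subst (\<lambda>v. Fun (e (inv w v)) (section_vars w d)) (rm_lhs ?M)"
      using subst_section_vars[OF w, of "\<lambda>i. Fun (e i) (section_vars w d)"]
      by (simp add: section_model_simps d_def)
    from matcher_eq[OF this vars_l[OF that]] show ?thesis
      using w by simp
  qed
  have \<sigma>: "matcher (rm_lhs ?M) (rm_init ?M) (w i) = Fun (e (Suc d + i)) []" if "i < d" for i
  proof -
    have "rm_init ?M = subst (\<lambda>v. Fun (e (Suc d + inv w v)) []) (rm_lhs ?M)"
      using subst_section_vars[OF w, of "\<lambda>i. Fun (e (Suc d + i)) []"]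
      by (simp add: section_model_simps d_def)
    from matcher_eq[OF this vars_l[OF that]] show ?thesis
      using w by simp
  qed
  have eval: "eval_trm ?c (valuation ?vs y) (Fun (e j) (section_vars w d)) = section_op D j y"
    if y: "y \<in> nlists d ?X" and j: "j \<le> d" for y j
  proof -
    have "map (eval_trm ?c (valuation ?vs y)) (section_vars w d) = map (valuation ?vs y) ?vs"
      by (simp add: section_vars_def)
    also have "\<dots> = y"
      using y by (intro map_valuation[OF dist]) simp
    finally show ?thesis
      using rm_alg_section_model[OF e, of j D d y w] section_sigI(1)[OF j, of e] y
      by (simp add: d_def)
  qed
  have "cs_step (project ?M) = cs_step D"
  proof (rule extensionalityI)
    show "cs_step (project ?M) \<in> extensional (nlists d ?X)"
      by (simp add: project_simps vs section_model_simps(1))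
    show "cs_step D \<in> extensional (nlists d ?X)"
      using G by (auto simp: PiE_def)
    fix y assume y: "y \<in> nlists d ?X"
    then have "length (cs_step D y) = d"
      using nlistsE_length[OF PiE_mem[OF G]] by simp
    with y show "cs_step (project ?M) y = cs_step D y"
      by (intro nth_equalityI)
        (auto simp: project_simps vs section_model_simps(1) \<tau> eval section_op_def d_def[symmetric]
          simp del: eval_trm.simps)
  qed
  moreover have "cs_obs (project ?M) = cs_obs D"
  proof (rule extensionalityI)
    show "cs_obs (project ?M) \<in> extensional (nlists d ?X)"
      by (simp add: project_simps vs section_model_simps(1))
    show "cs_obs D \<in> extensional (nlists d ?X)"
      using f by (auto simp: PiE_def)
    fix y assume y: "y \<in> nlists d ?X"
    then show "cs_obs (project ?M) y = cs_obs D y"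
      using eval[OF y, of d]
      by (simp add: project_simps vs section_model_simps(1,4,6) section_op_def d_def[symmetric]
          del: eval_trm.simps)
  qed
  moreover have "cs_init (project ?M) = cs_init D"
  proof (rule nth_equalityI)
    show len: "length (cs_init (project ?M)) = length (cs_init D)"
      using nlistsE_length[OF y0] by (simp add: project_simps vs)
    fix i assume "i < length (cs_init (project ?M))"
    then have i: "i < d"
      by (simp add: project_simps vs)
    have "cata ?c (Fun (e (Suc d + i)) []) = section_op D (Suc d + i) []"
      using rm_alg_section_model[OF e, of "Suc d + i" D 0 "[]" w] section_sigI(2)[OF i, of e]
      by (simp add: d_def)
    then show "cs_init (project ?M) ! i = cs_init D ! i"
      using i by (simp add: project_simps vs section_model_simps(6) \<sigma> section_op_def d_def[symmetric]
          del: cata.simps)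
  qed
  moreover have "cs_out (project ?M) = cs_out D" "cs_dim (project ?M) = cs_dim D"
    by (simp_all add: project_simps vs section_model_simps(1) d_def)
  ultimately show ?thesis
    by (intro cartesian_system.equality) auto
qed

section \<open>The projection and its section\<close>

theorem theorem6p3:
  assumes "infinite (UNIV :: 'f set)" and "infinite (UNIV :: 'v set)"
  shows "\<exists>(P :: ('f, 'v, 'x) rewriting_model \<Rightarrow> 'x cartesian_system)
          (S :: 'x cartesian_system \<Rightarrow> ('f, 'v, 'x) rewriting_model).
    (\<forall>M. is_rewriting_model M \<longrightarrow>
       is_cartesian_system (P M) \<and> cs_out (P M) = rm_out M \<and> cs_seq (P M) = rm_seq M) \<and>
    (\<forall>D. is_cartesian_system D \<longrightarrow>
       is_rewriting_model (S D) \<and> rm_out (S D) = cs_out D \<and> rm_seq (S D) = cs_seq D) \<and>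
    (\<forall>D. is_cartesian_system D \<longrightarrow> P (S D) = D)"
proof -
  obtain e :: "nat \<Rightarrow> 'f" where e: "inj e"
    using assms(1) infinite_countable_subset by blast
  obtain w :: "nat \<Rightarrow> 'v" where w: "inj w"
    using assms(2) infinite_countable_subset by blast
  have "rm_seq (section_model e w D) = cs_seq D" if "is_cartesian_system D"
    for D :: "'x cartesian_system"
    using cs_seq_project[OF is_rewriting_model_section_model[OF e w that]]
    by (simp add: project_section_model[OF e w that])
  then show ?thesis
    using is_rewriting_model_section_model[OF e w] project_section_model[OF e w]
    by (intro exI[of _ project] exI[of _ "section_model e w"])
      (auto simp: is_cartesian_system_project cs_seq_project project_simps(1)
        section_model_simps(1))
qed

end
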